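(* Let $(M,g,q)$ be a $3$-dimensional Riemannian manifold with circulant structure $q$ as in the context, let $f$ be the associated metric, let $p\in M$, and let $\{u,qu,q^{2}u\}$ be a $g$-orthonormal $q$-basis of $T_pM$. Let $p_{xyz}$ be the coordinate system on $T_pM$ with origin $p$ (the zero vector) whose axes $p_x,p_y,p_z$ are directed along $u,qu,q^2u$, so that the point $(x,y,z)$ has radius vector $xu+y\,qu+z\,q^2u$. Let $p_{x'y'z'}$ be the coordinate system obtained from $p_{xyz}$ by the rotation $$x=\tfrac{1}{\sqrt2}x'-\tfrac{1}{\sqrt6}y'+\tfrac{1}{\sqrt3}z',\qquad y=\tfrac{\sqrt2}{\sqrt3}y'+\tfrac{1}{\sqrt3}z',\qquad z=-\tfrac{1}{\sqrt2}x'-\tfrac{1}{\sqrt6}y'+\tfrac{1}{\sqrt3}z'.$$ Then $u$, $qu$ and $q^2u$ are null vectors with respect to $f$, and their heads lie at the circles $$x'^2+y'^2=\frac23,\qquad z'=\pm\frac{1}{\sqrt3}$$ (that is, each head lies on the union of these two circles).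
   Context: $(M,g,q)$ denotes a $3$-dimensional differentiable manifold $M$ with a $(1,1)$-tensor field $q$ whose components in a local coordinate system form the circulant matrix $\begin{pmatrix}0&1&0\\0&0&1\\1&0&0\end{pmatrix}$ (so $q^3=\mathrm{id}$), and a positive definite metric $g$ with $g(qu,qv)=g(u,v)$ for all $u,v$. The associated metric is $f(u,v)=g(u,qv)+g(qu,v)$; it is indefinite. A $q$-basis of $T_pM$ is a basis of the form $\{u,qu,q^2u\}$; orthonormal means orthonormal with respect to $g$. A nonzero vector $v$ is null (with respect to $f$) if $f(v,v)=0$. The head of a vector is the point of $T_pM$ having that vector as radius vector from the origin $p$. *)

theory Defs
  imports "HOL-Analysis.Analysis" "HOL-Library.Function_Algebras"
begin

section \<open>Pointwise real vector space structure on functions\<close>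

instantiation "fun" :: (type, real_vector) real_vector
begin

definition scaleR_fun :: "real \<Rightarrow> ('a \<Rightarrow> 'b) \<Rightarrow> 'a \<Rightarrow> 'b" where
  "scaleR_fun r f = (\<lambda>x. r *\<^sub>R f x)"

instance
  by standard (auto simp: scaleR_fun_def fun_eq_iff plus_fun_def scaleR_add_right scaleR_add_left)

end


section \<open>Three-dimensional differentiable manifolds\<close>

fun Ck_on :: "nat \<Rightarrow> (real^3) set \<Rightarrow> (real^3 \<Rightarrow> 'b::real_normed_vector) \<Rightarrow> bool" where
  "Ck_on 0 S h \<longleftrightarrow> continuous_on S h"
| "Ck_on (Suc k) S h \<longleftrightarrow>
     (\<forall>x\<in>S. h differentiable (at x)) \<and> (\<forall>v. Ck_on k S (\<lambda>x. frechet_derivative h (at x) v))"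

text \<open>Only used for open \<open>S\<close>.\<close>
definition smooth_on :: "(real^3) set \<Rightarrow> (real^3 \<Rightarrow> 'b::real_normed_vector) \<Rightarrow> bool" where
  "smooth_on S h \<longleftrightarrow> (\<forall>k. Ck_on k S h)"

text \<open>A chart is a pair of its domain and its coordinate map; the values of the coordinate map
  outside the domain are irrelevant.\<close>
type_synonym 'a chart = "'a set \<times> ('a \<Rightarrow> real^3)"

abbreviation cdom :: "'a chart \<Rightarrow> 'a set" where "cdom c \<equiv> fst c"
abbreviation cmap :: "'a chart \<Rightarrow> 'a \<Rightarrow> real^3" where "cmap c \<equiv> snd c"

definition cinv :: "'a chart \<Rightarrow> real^3 \<Rightarrow> 'a" where
  "cinv c = inv_into (cdom c) (cmap c)"

definition is_chart :: "'a topology \<Rightarrow> 'a chart \<Rightarrow> bool" where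
  "is_chart X c \<longleftrightarrow> openin X (cdom c) \<and> open (cmap c ` cdom c) \<and>
     homeomorphic_map (subtopology X (cdom c)) (top_of_set (cmap c ` cdom c)) (cmap c)"

definition transition :: "'a chart \<Rightarrow> 'a chart \<Rightarrow> real^3 \<Rightarrow> real^3" where
  "transition c d = cmap d \<circ> cinv c"

definition compatible :: "'a chart \<Rightarrow> 'a chart \<Rightarrow> bool" where
  "compatible c d \<longleftrightarrow> smooth_on (cmap c ` (cdom c \<inter> cdom d)) (transition c d) \<and>
     smooth_on (cmap d ` (cdom c \<inter> cdom d)) (transition d c)"

text \<open>The equation for \<open>A\<close> says at once that the charts in \<open>A\<close> are pairwise compatible and that
  \<open>A\<close> is maximal with this property.\<close>
definition manifold3 :: "'a topology \<Rightarrow> 'a chart set \<Rightarrow> bool" where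
  "manifold3 X A \<longleftrightarrow> Hausdorff_space X \<and> second_countable X \<and>
     (\<Union>c\<in>A. cdom c) = topspace X \<and>
     A = {c. is_chart X c \<and> (\<forall>d\<in>A. compatible c d)}"


section \<open>Tangent vectors and tensor fields\<close>

text \<open>A tangent vector at \<open>p\<close> is the family of its coordinate columns with respect to all charts
  around \<open>p\<close>, related by the Jacobians of the coordinate changes. It is set to zero at the
  remaining charts, so that equality of tangent vectors is equality of functions.\<close>
type_synonym 'a tvec = "'a chart \<Rightarrow> real^3"

definition tangent_space :: "'a chart set \<Rightarrow> 'a \<Rightarrow> 'a tvec set" where
  "tangent_space A p = {v.
     (\<forall>c. c \<notin> A \<or> p \<notin> cdom c \<longrightarrow> v c = 0) \<and>
     (\<forall>c\<in>A. \<forall>d\<in>A. p \<in> cdom c \<inter> cdom d \<longrightarrow>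
        v d = frechet_derivative (transition c d) (at (cmap c p)) (v c))}"

text \<open>The coordinate vector \<open>\<partial>/\<partial>x\<^sup>i\<close> of the chart \<open>c\<close> at \<open>p\<close>.\<close>
definition coord_vec :: "'a chart set \<Rightarrow> 'a chart \<Rightarrow> 'a \<Rightarrow> 3 \<Rightarrow> 'a tvec" where
  "coord_vec A c p i = (\<lambda>d. if d \<in> A \<and> p \<in> cdom d
     then frechet_derivative (transition c d) (at (cmap c p)) (axis i 1) else 0)"

definition metric_components ::
    "'a chart set \<Rightarrow> ('a \<Rightarrow> 'a tvec \<Rightarrow> 'a tvec \<Rightarrow> real) \<Rightarrow> 'a chart \<Rightarrow> 'a \<Rightarrow> real^3^3" where
  "metric_components A g c p = (\<chi> i j. g p (coord_vec A c p i) (coord_vec A c p j))"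

text \<open>The matrix whose \<open>j\<close>-th column consists of the coordinates of the image of \<open>\<partial>/\<partial>x\<^sup>j\<close>.\<close>
definition endo_components ::
    "'a chart set \<Rightarrow> ('a \<Rightarrow> 'a tvec \<Rightarrow> 'a tvec) \<Rightarrow> 'a chart \<Rightarrow> 'a \<Rightarrow> real^3^3" where
  "endo_components A q c p = (\<chi> i j. q p (coord_vec A c p j) c $ i)"

definition riemannian_metric ::
    "'a topology \<Rightarrow> 'a chart set \<Rightarrow> ('a \<Rightarrow> 'a tvec \<Rightarrow> 'a tvec \<Rightarrow> real) \<Rightarrow> bool" where
  "riemannian_metric X A g \<longleftrightarrow>
     (\<forall>p\<in>topspace X. \<forall>u\<in>tangent_space A p. \<forall>v\<in>tangent_space A p.
        g p u v = g p v u \<and>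
        (u \<noteq> 0 \<longrightarrow> g p u u > 0) \<and>
        (\<forall>w\<in>tangent_space A p. \<forall>a b. g p (a *\<^sub>R u + b *\<^sub>R v) w = a * g p u w + b * g p v w)) \<and>
     (\<forall>c\<in>A. smooth_on (cmap c ` cdom c) (\<lambda>x. metric_components A g c (cinv c x)))"

text \<open>Tensor fields of type (1,1), viewed as smooth fields of endomorphisms of the tangent
  spaces.\<close>
definition tensor_field_1_1 ::
    "'a topology \<Rightarrow> 'a chart set \<Rightarrow> ('a \<Rightarrow> 'a tvec \<Rightarrow> 'a tvec) \<Rightarrow> bool" where
  "tensor_field_1_1 X A q \<longleftrightarrow>
     (\<forall>p\<in>topspace X. \<forall>u\<in>tangent_space A p. q p u \<in> tangent_space A p \<and>
        (\<forall>v\<in>tangent_space A p. \<forall>a b. q p (a *\<^sub>R u + b *\<^sub>R v) = a *\<^sub>R q p u + b *\<^sub>R q p v)) \<and>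
     (\<forall>c\<in>A. smooth_on (cmap c ` cdom c) (\<lambda>x. endo_components A q c (cinv c x)))"


section \<open>Riemannian manifolds with circulant structure\<close>

definition circulant_matrix :: "real^3^3" where
  "circulant_matrix = vector [vector [0, 1, 0], vector [0, 0, 1], vector [1, 0, 0]]"

definition circulant_structure ::
    "'a topology \<Rightarrow> 'a chart set \<Rightarrow> ('a \<Rightarrow> 'a tvec \<Rightarrow> 'a tvec) \<Rightarrow> bool" where
  "circulant_structure X A q \<longleftrightarrow> tensor_field_1_1 X A q \<and>
     (\<forall>p\<in>topspace X. \<exists>c\<in>A. p \<in> cdom c \<and>
        (\<forall>r\<in>cdom c. endo_components A q c r = circulant_matrix))"

definition circulant_riemannian_manifold ::
    "'a topology \<Rightarrow> 'a chart set \<Rightarrow> ('a \<Rightarrow> 'a tvec \<Rightarrow> 'a tvec \<Rightarrow> real) \<Rightarrow>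
     ('a \<Rightarrow> 'a tvec \<Rightarrow> 'a tvec) \<Rightarrow> bool" where
  "circulant_riemannian_manifold X A g q \<longleftrightarrow>
     manifold3 X A \<and> riemannian_metric X A g \<and> circulant_structure X A q \<and>
     (\<forall>p\<in>topspace X. \<forall>u\<in>tangent_space A p. \<forall>v\<in>tangent_space A p.
        g p (q p u) (q p v) = g p u v)"

definition associated_metric ::
    "('a \<Rightarrow> 'a tvec \<Rightarrow> 'a tvec \<Rightarrow> real) \<Rightarrow> ('a \<Rightarrow> 'a tvec \<Rightarrow> 'a tvec) \<Rightarrow>
     'a \<Rightarrow> 'a tvec \<Rightarrow> 'a tvec \<Rightarrow> real" where
  "associated_metric g q p u v = g p u (q p v) + g p (q p u) v"

definition q_basis ::
    "'a chart set \<Rightarrow> ('a \<Rightarrow> 'a tvec \<Rightarrow> 'a tvec) \<Rightarrow> 'a \<Rightarrow> 'a tvec \<Rightarrow> bool" where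
  "q_basis A q p u \<longleftrightarrow> distinct [u, q p u, q p (q p u)] \<and>
     independent {u, q p u, q p (q p u)} \<and> span {u, q p u, q p (q p u)} = tangent_space A p"

definition orthonormal_wrt :: "('v \<Rightarrow> 'v \<Rightarrow> real) \<Rightarrow> 'v set \<Rightarrow> bool" where
  "orthonormal_wrt h S \<longleftrightarrow> (\<forall>v\<in>S. \<forall>w\<in>S. h v w = (if v = w then 1 else 0))"

definition null_vector :: "('v::zero \<Rightarrow> 'v \<Rightarrow> real) \<Rightarrow> 'v \<Rightarrow> bool" where
  "null_vector h v \<longleftrightarrow> v \<noteq> 0 \<and> h v v = 0"


section \<open>Coordinate systems on the tangent space\<close>

text \<open>Points of the tangent space are identified with their radius vectors, so that the head of a
  vector is the vector itself.\<close>

definition point_xyz ::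
    "('a \<Rightarrow> 'a tvec \<Rightarrow> 'a tvec) \<Rightarrow> 'a \<Rightarrow> 'a tvec \<Rightarrow> real \<Rightarrow> real \<Rightarrow> real \<Rightarrow> 'a tvec" where
  "point_xyz q p u x y z = x *\<^sub>R u + y *\<^sub>R q p u + z *\<^sub>R q p (q p u)"

definition point_rotated ::
    "('a \<Rightarrow> 'a tvec \<Rightarrow> 'a tvec) \<Rightarrow> 'a \<Rightarrow> 'a tvec \<Rightarrow> real \<Rightarrow> real \<Rightarrow> real \<Rightarrow> 'a tvec" where
  "point_rotated q p u x' y' z' = point_xyz q p u
     (1 / sqrt 2 * x' - 1 / sqrt 6 * y' + 1 / sqrt 3 * z')
     (sqrt 2 / sqrt 3 * y' + 1 / sqrt 3 * z')
     (- (1 / sqrt 2) * x' - 1 / sqrt 6 * y' + 1 / sqrt 3 * z')"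

end

theory Submission
  imports Defs
begin

text \<open>On a unit vector \<open>w\<close>, the associated metric \<open>f w w = g w (q w) + g (q w) w\<close> is twice the
  cosine of the angle between \<open>w\<close> and \<open>q w\<close>. For the first two vectors of an orthonormal \<open>q\<close>-basis this
  vanishes because neighbours in the basis are orthogonal, and since \<open>q\<close> is an isometry it maps
  null vectors to null vectors, which settles \<open>q\<^sup>2 u\<close>.

  The \<open>z'\<close>-axis is spanned by \<open>u + q u + q\<^sup>2 u\<close>, the direction about which \<open>q\<close> rotates the three
  basis vectors. Hence they share the value \<open>(x + y + z) / sqrt 3 = 1 / sqrt 3\<close> of \<open>z'\<close> and the
  distance from that axis: having length \<open>1\<close>, they satisfy \<open>x'\<^sup>2 + y'\<^sup>2 = 1 - 1/3 = 2/3\<close>. All three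
  heads therefore lie on the circle with positive \<open>z'\<close>. The lemmas \<open>point_xyz_eq_point_rotated\<close> and
  \<open>distance_from_axis_rotated\<close> make this precise by inverting the rotation.\<close>

lemma q_in_tangent_space:
  assumes "circulant_riemannian_manifold X A g q" "p \<in> topspace X" "v \<in> tangent_space A p"
  shows "q p v \<in> tangent_space A p"
  using assms
  unfolding circulant_riemannian_manifold_def circulant_structure_def tensor_field_1_1_def
  by blast

lemma metric_q_invariant:
  assumes "circulant_riemannian_manifold X A g q" "p \<in> topspace X"
    and "v \<in> tangent_space A p" "w \<in> tangent_space A p"
  shows "g p (q p v) (q p w) = g p v w"
  using assms unfolding circulant_riemannian_manifold_def by blast

text \<open>Both summands of \<open>f\<close> are values of \<open>g\<close>, so \<open>f\<close> inherits the invariance of \<open>g\<close>. This carries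
  nullity from \<open>q u\<close> over to \<open>q\<^sup>2 u\<close>.\<close>
lemma associated_metric_q_invariant:
  assumes "circulant_riemannian_manifold X A g q" "p \<in> topspace X"
    and "v \<in> tangent_space A p" "w \<in> tangent_space A p"
  shows "associated_metric g q p (q p v) (q p w) = associated_metric g q p v w"
  unfolding associated_metric_def
  using assms by (simp add: metric_q_invariant q_in_tangent_space)

text \<open>The rotation matrix is orthogonal, so its transpose yields the new coordinates; the middle
  entry appears as \<open>2 y / sqrt 6\<close> because \<open>sqrt 2 / sqrt 3 = 2 / sqrt 6\<close>.\<close>
lemma point_xyz_eq_point_rotated:
  "point_xyz q p u x y z =
     point_rotated q p u ((x - z) / sqrt 2) ((2 * y - x - z) / sqrt 6) ((x + y + z) / sqrt 3)"
proof -
  have mult_sqrt: "1 / sqrt (numeral n) * (t / sqrt (numeral n)) = t / numeral n" for n and t :: real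
    by simp
  have sqrt6: "sqrt 6 = sqrt 2 * sqrt (3::real)"
    by (simp flip: real_sqrt_mult)
  have middle: "sqrt 2 / sqrt 3 * (t / sqrt 6) = t / 3" for t :: real
    by (simp add: sqrt6)
  have "1 / sqrt 2 * ((x - z) / sqrt 2) - 1 / sqrt 6 * ((2 * y - x - z) / sqrt 6)
      + 1 / sqrt 3 * ((x + y + z) / sqrt 3) = x"
    by (simp only: mult_sqrt) (simp add: field_simps)
  moreover have "sqrt 2 / sqrt 3 * ((2 * y - x - z) / sqrt 6)
      + 1 / sqrt 3 * ((x + y + z) / sqrt 3) = y"
    by (simp only: mult_sqrt middle) (simp add: field_simps)
  moreover have "- (1 / sqrt 2) * ((x - z) / sqrt 2) - 1 / sqrt 6 * ((2 * y - x - z) / sqrt 6)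
      + 1 / sqrt 3 * ((x + y + z) / sqrt 3) = z"
    by (simp only: mult_sqrt mult_minus_left) (simp add: field_simps)
  ultimately show ?thesis
    unfolding point_rotated_def by simp
qed

text \<open>The rotation preserves the length, so the squared distance from the \<open>z'\<close>-axis is what
  remains of it after subtracting \<open>z'\<^sup>2\<close>.\<close>
lemma distance_from_axis_rotated:
  fixes x y z :: real
  shows "((x - z) / sqrt 2)\<^sup>2 + ((2 * y - x - z) / sqrt 6)\<^sup>2 =
    x\<^sup>2 + y\<^sup>2 + z\<^sup>2 - (x + y + z)\<^sup>2 / 3"
  by (simp add: power_divide) (simp add: field_simps power2_eq_square)

lemma point_on_circle:
  assumes "x\<^sup>2 + y\<^sup>2 + z\<^sup>2 = 1" "x + y + z = 1"
  shows "point_xyz q p u x y z \<in>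
    {point_rotated q p u x' y' z' | x' y' z'. x'\<^sup>2 + y'\<^sup>2 = 2 / 3 \<and> z' = 1 / sqrt 3}"
proof -
  have "((x - z) / sqrt 2)\<^sup>2 + ((2 * y - x - z) / sqrt 6)\<^sup>2 = 2 / 3"
    unfolding distance_from_axis_rotated assms by simp
  then show ?thesis
    unfolding point_xyz_eq_point_rotated assms(2) by blast
qed

theorem theorem4p3:
  fixes X :: "'a topology" and A :: "'a chart set"
    and g :: "'a \<Rightarrow> 'a tvec \<Rightarrow> 'a tvec \<Rightarrow> real"
    and q :: "'a \<Rightarrow> 'a tvec \<Rightarrow> 'a tvec"
    and p :: 'a and u :: "'a tvec"
  assumes "circulant_riemannian_manifold X A g q"
    and "p \<in> topspace X"
    and "u \<in> tangent_space A p"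
    and "q_basis A q p u"
    and "orthonormal_wrt (g p) {u, q p u, q p (q p u)}"
  shows "\<forall>w\<in>{u, q p u, q p (q p u)}.
    null_vector (associated_metric g q p) w \<and>
    w \<in> {point_rotated q p u x' y' z' | x' y' z'. x'\<^sup>2 + y'\<^sup>2 = 2 / 3 \<and> z' = 1 / sqrt 3} \<union>
        {point_rotated q p u x' y' z' | x' y' z'. x'\<^sup>2 + y'\<^sup>2 = 2 / 3 \<and> z' = - (1 / sqrt 3)}"
proof -
  let ?f = "associated_metric g q p"
  let ?C = "{point_rotated q p u x' y' z' | x' y' z'. x'\<^sup>2 + y'\<^sup>2 = 2 / 3 \<and> z' = 1 / sqrt 3}"
  have dist: "u \<noteq> q p u" "q p u \<noteq> q p (q p u)"
    using assms(4) by (auto simp: q_basis_def)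
  have "independent {u, q p u, q p (q p u)}"
    using assms(4) unfolding q_basis_def by (elim conjE)
  then have nonzero: "u \<noteq> 0" "q p u \<noteq> 0" "q p (q p u) \<noteq> 0"
    using dependent_zero[of "{u, q p u, q p (q p u)}"] by auto
  have orthonormal: "g p v w = (if v = w then 1 else 0)"
    if "v \<in> {u, q p u, q p (q p u)}" "w \<in> {u, q p u, q p (q p u)}" for v w
    using assms(5)[unfolded orthonormal_wrt_def, rule_format, OF that] .
  have f_u: "?f u u = 0"
    using orthonormal[of u "q p u"] orthonormal[of "q p u" u] dist(1)
    by (simp add: associated_metric_def)
  have f_qu: "?f (q p u) (q p u) = 0"
    using orthonormal[of "q p u" "q p (q p u)"] orthonormal[of "q p (q p u)" "q p u"] dist(2)
    by (simp add: associated_metric_def)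
  have f_qqu: "?f (q p (q p u)) (q p (q p u)) = 0"
    using associated_metric_q_invariant[OF assms(1,2)
        q_in_tangent_space[OF assms(1-3)] q_in_tangent_space[OF assms(1-3)]] f_qu
    by simp
  have "point_xyz q p u 1 0 0 \<in> ?C" "point_xyz q p u 0 1 0 \<in> ?C" "point_xyz q p u 0 0 1 \<in> ?C"
    by (rule point_on_circle; simp)+
  then have circle: "u \<in> ?C" "q p u \<in> ?C" "q p (q p u) \<in> ?C"
    unfolding point_xyz_def by simp_all
  have "\<forall>w\<in>{u, q p u, q p (q p u)}. null_vector ?f w \<and> w \<in> ?C"
    unfolding null_vector_def ball_simps
    by (intro conjI nonzero f_u f_qu f_qqu circle TrueI)
  then show ?thesis
    by (meson UnI1)
qed

end
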